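(* Let $p\ge1$. Consider the fully composite problem $\varphi^*=\min_{x\in\operatorname{dom}\varphi}\{\varphi(x)=F(x,f(x))\}$ (see context), where each component $f_i$, $i=1,\dots,m$, of $f$ is $p$ times continuously differentiable with $p$th derivative Lipschitz continuous with constant $L_p(f_i)\in(0,+\infty)$, and uniformly convex of degree $p+1$ with constant $\sigma_{p+1}(f_i)>0$. Let $\hat\beta_p(f)=\min_{1\le i\le m}\beta_p(f_i,p)$ and $\beta\in(0,\hat\beta_p(f)]$. Let $x_0\in\operatorname{dom}\varphi$ and let $\{x_k\}_{k\ge0}$ be generated by $$x_{k+1}\in\operatorname*{argmin}_{y}\Big\{F\Big(y,\ \Omega_p(f,x_k;y)+\tfrac{p\,L_p(f)}{(p+1)!}\|y-x_k\|^{p+1}\Big):\ x_k+\tfrac1\beta(y-x_k)\in\operatorname{dom}\varphi\Big\},\qquad k\ge0$$ (the Restricted $p$th order Basic Method; minimizers are assumed to exist). Then for all $k\ge0$, $$\varphi(x_k)-\varphi^*\ \le\ (1-\beta)^k(\varphi(x_0)-\varphi^* ).$$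
   Context: $\mathbb{E}$ is a finite-dimensional real vector space with norm $\|x\|=\langle Bx,x\rangle^{1/2}$, where $B:\mathbb{E}\to\mathbb{E}^*$ is self-adjoint positive definite. Fully composite problem: $F:\mathbb{E}\times\mathbb{R}^m\to\mathbb{R}\cup\{+\infty\}$ is closed and convex; for every $x$, with $\mathcal{D}(x)=\{u:F(x,u)<+\infty\}\neq\emptyset$, the function $F(x,\cdot)$ is closed, convex and monotone: $u\le v$ componentwise implies $F(x,u)\le F(x,v)$ (as extended real values). $f=(f_1,\dots,f_m)^T:\operatorname{dom} f\to\mathbb{R}^m$ with $\operatorname{dom} f\subseteq\mathbb{E}$ open convex, and all $f_i$ closed and convex. $\varphi(x)=F(x,f(x))$, $\operatorname{dom}\varphi=\{x\in\operatorname{dom} f:(x,f(x))\in\operatorname{dom} F\}$, and a minimizer $x^*$ with $\varphi(x^* )=\varphi^*$ is assumed to exist. $D^kf(x)[h]^k$ is the $k$th directional derivative along $h$ repeated $k$ times (componentwise for vector functions); $\Omega_p(f,x;y)=f(x)+\sum_{k=1}^p\frac1{k!}D^kf(x)[y-x]^k$ is the (componentwise) Taylor polynomial. $\|D^pg(x)\|=\max\{D^pg(x)[h_1,\dots,h_p]:\|h_i\|\le1\}$, and $L_p(g)$ is a constant with $\|D^pg(x)-D^pg(y)\|\le L_p(g)\|x-y\|$ on $\operatorname{dom} f$; $L_p(f)=(L_p(f_1),\dots,L_p(f_m))^T$. Uniform convexity of degree $p+1$ of $g$: $\langle\nabla g(y)-\nabla g(x),y-x\rangle\ge\sigma_{p+1}(g)\|y-x\|^{p+1}$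 on $\operatorname{dom} f$. With $\gamma_p(g)=\sigma_{p+1}(g)/L_p(g)$, $\beta_p(g,\alpha)=\dfrac{(p!\,\gamma_p(g))^{1/p}}{(1+\alpha)^{1/p}+(p!\,\gamma_p(g))^{1/p}}$ for $\alpha\ge0$. *)

theory Defs
  imports "HOL-Analysis.Analysis"
begin

(* B is an operator from the space into its dual, so "B x y" is the pairing of B x with y. *)

definition self_adjoint_posdef :: "('a::euclidean_space \<Rightarrow>\<^sub>L 'a \<Rightarrow>\<^sub>L real) \<Rightarrow> bool" where
  "self_adjoint_posdef B \<longleftrightarrow> (\<forall>x y. B x y = B y x) \<and> (\<forall>x. x \<noteq> 0 \<longrightarrow> B x x > 0)"

definition Bnorm :: "('a::euclidean_space \<Rightarrow>\<^sub>L 'a \<Rightarrow>\<^sub>L real) \<Rightarrow> 'a \<Rightarrow> real" where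
  "Bnorm B x = sqrt (B x x)"

text \<open>
  Convexity and closedness of an extended-real-valued function are those of its epigraph, whose
  heights are real numbers; the value \<open>-\<infinity>\<close> is excluded separately.
\<close>

definition ereal_epigraph :: "('a \<Rightarrow> ereal) \<Rightarrow> ('a \<times> real) set" where
  "ereal_epigraph G = {(z, t). G z \<le> ereal t}"

definition closed_convex_fun :: "('a::real_normed_vector \<Rightarrow> ereal) \<Rightarrow> bool" where
  "closed_convex_fun G \<longleftrightarrow>
     (\<forall>z. G z \<noteq> -\<infinity>) \<and> closed (ereal_epigraph G) \<and> convex (ereal_epigraph G)"

text \<open>
  \<open>g\<close> is \<open>p\<close> times continuously differentiable on the (open) set \<open>S\<close>.
\<close>

primrec C_times_on :: "nat \<Rightarrow> 'a::real_normed_vector set \<Rightarrow> ('a \<Rightarrow> real) \<Rightarrow> bool" where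
  "C_times_on 0 S g \<longleftrightarrow> continuous_on S g"
| "C_times_on (Suc p) S g \<longleftrightarrow>
     (\<forall>x\<in>S. g differentiable (at x)) \<and>
     (\<forall>h. C_times_on p S (\<lambda>x. frechet_derivative g (at x) h))"

text \<open>
  \<open>Dmulti g [h\<^sub>1, \<dots>, h\<^sub>k] x\<close> is \<open>D\<^sup>kg(x)[h\<^sub>1, \<dots>, h\<^sub>k]\<close>, the iterated directional derivative.
\<close>

primrec Dmulti :: "('a::real_normed_vector \<Rightarrow> real) \<Rightarrow> 'a list \<Rightarrow> 'a \<Rightarrow> real" where
  "Dmulti g [] = g"
| "Dmulti g (h # hs) = (\<lambda>x. deriv (\<lambda>t::real. Dmulti g hs (x + t *\<^sub>R h)) 0)"

definition Dpow :: "nat \<Rightarrow> ('a::real_normed_vector \<Rightarrow> real^'m) \<Rightarrow> 'a \<Rightarrow> 'a \<Rightarrow> real^'m" where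
  "Dpow k f x h = (\<chi> i. Dmulti (\<lambda>z. f z $ i) (replicate k h) x)"

definition taylor_poly ::
  "nat \<Rightarrow> ('a::real_normed_vector \<Rightarrow> real^'m) \<Rightarrow> 'a \<Rightarrow> 'a \<Rightarrow> real^'m" where
  "taylor_poly p f x y = f x + (\<Sum>k=1..p. (1 / fact k) *\<^sub>R Dpow k f x (y - x))"

text \<open>
  Norm of a \<open>p\<close>-linear form \<open>A\<close>, given as a function of the list of its arguments. In finite
  dimension the supremum is attained, i.e. it is a maximum.
\<close>

definition form_norm ::
  "('a::euclidean_space \<Rightarrow>\<^sub>L 'a \<Rightarrow>\<^sub>L real) \<Rightarrow> nat \<Rightarrow> ('a list \<Rightarrow> real) \<Rightarrow> real" where
  "form_norm B p A = Sup {A hs | hs. length hs = p \<and> (\<forall>h\<in>set hs. Bnorm B h \<le> 1)}"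

definition lipschitz_pth_deriv ::
  "('a::euclidean_space \<Rightarrow>\<^sub>L 'a \<Rightarrow>\<^sub>L real) \<Rightarrow> nat \<Rightarrow> 'a set \<Rightarrow> ('a \<Rightarrow> real) \<Rightarrow> real \<Rightarrow> bool" where
  "lipschitz_pth_deriv B p S g L \<longleftrightarrow>
     (\<forall>x\<in>S. \<forall>y\<in>S. form_norm B p (\<lambda>hs. Dmulti g hs x - Dmulti g hs y) \<le> L * Bnorm B (x - y))"

text \<open>
  Uniform convexity of degree \<open>q\<close>; the gradient at \<open>x\<close> is the functional
  \<open>frechet_derivative g (at x)\<close>.
\<close>

definition uniformly_convex_on ::
  "('a::euclidean_space \<Rightarrow>\<^sub>L 'a \<Rightarrow>\<^sub>L real) \<Rightarrow> nat \<Rightarrow> 'a set \<Rightarrow> ('a \<Rightarrow> real) \<Rightarrow> real \<Rightarrow> bool" where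
  "uniformly_convex_on B q S g \<sigma> \<longleftrightarrow>
     (\<forall>x\<in>S. \<forall>y\<in>S.
        frechet_derivative g (at y) (y - x) - frechet_derivative g (at x) (y - x)
          \<ge> \<sigma> * Bnorm B (y - x) ^ q)"

definition cond_gamma :: "real \<Rightarrow> real \<Rightarrow> real" where
  "cond_gamma \<sigma> L = \<sigma> / L"

definition cond_beta :: "nat \<Rightarrow> real \<Rightarrow> real \<Rightarrow> real" where
  "cond_beta p \<gamma> \<alpha> =
     (fact p * \<gamma>) powr (1 / real p) / ((1 + \<alpha>) powr (1 / real p) + (fact p * \<gamma>) powr (1 / real p))"

definition beta_hat :: "nat \<Rightarrow> real^'m \<Rightarrow> real^'m \<Rightarrow> real" where
  "beta_hat p \<sigma> L = Min (range (\<lambda>i. cond_beta p (cond_gamma (\<sigma> $ i) (L $ i)) (real p)))"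

text \<open>
  Problem data: the outer function \<open>F\<close>, and the inner map \<open>f\<close>, defined on \<open>Q = dom f\<close> (its values
  outside \<open>Q\<close> are irrelevant). The order on \<open>real^'m\<close> is the componentwise one.
\<close>

definition outer_function :: "('a::euclidean_space \<times> (real^'m) \<Rightarrow> ereal) \<Rightarrow> bool" where
  "outer_function F \<longleftrightarrow>
     closed_convex_fun F \<and>
     (\<forall>x. {u. F (x, u) < \<infinity>} \<noteq> {} \<longrightarrow>
        closed_convex_fun (\<lambda>u. F (x, u)) \<and> (\<forall>u v. u \<le> v \<longrightarrow> F (x, u) \<le> F (x, v)))"

definition inner_function :: "'a::euclidean_space set \<Rightarrow> ('a \<Rightarrow> real^'m) \<Rightarrow> bool" where
  "inner_function Q f \<longleftrightarrow>
     open Q \<and> convex Q \<and>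
     (\<forall>i. convex_on Q (\<lambda>x. f x $ i) \<and> closed (epigraph Q (\<lambda>x. f x $ i)))"

definition dom_phi ::
  "('a \<times> (real^'m) \<Rightarrow> ereal) \<Rightarrow> 'a set \<Rightarrow> ('a \<Rightarrow> real^'m) \<Rightarrow> 'a set" where
  "dom_phi F Q f = {x \<in> Q. F (x, f x) < \<infinity>}"

definition phi ::
  "('a \<times> (real^'m) \<Rightarrow> ereal) \<Rightarrow> 'a set \<Rightarrow> ('a \<Rightarrow> real^'m) \<Rightarrow> 'a \<Rightarrow> ereal" where
  "phi F Q f x = (if x \<in> Q then F (x, f x) else \<infinity>)"

definition model ::
  "('a::euclidean_space \<Rightarrow>\<^sub>L 'a \<Rightarrow>\<^sub>L real) \<Rightarrow> nat \<Rightarrow> ('a \<times> (real^'m) \<Rightarrow> ereal) \<Rightarrow> ('a \<Rightarrow> real^'m)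
    \<Rightarrow> real^'m \<Rightarrow> 'a \<Rightarrow> 'a \<Rightarrow> ereal" where
  "model B p F f L x y =
     F (y, taylor_poly p f x y + (real p / fact (p + 1) * Bnorm B (y - x) ^ (p + 1)) *\<^sub>R L)"

definition restricted_basic_method ::
  "('a::euclidean_space \<Rightarrow>\<^sub>L 'a \<Rightarrow>\<^sub>L real) \<Rightarrow> nat \<Rightarrow> ('a \<times> (real^'m) \<Rightarrow> ereal) \<Rightarrow> 'a set
    \<Rightarrow> ('a \<Rightarrow> real^'m) \<Rightarrow> real^'m \<Rightarrow> real \<Rightarrow> (nat \<Rightarrow> 'a) \<Rightarrow> bool" where
  "restricted_basic_method B p F Q f L \<beta> x \<longleftrightarrow>
     x 0 \<in> dom_phi F Q f \<and>
     (\<forall>k. is_arg_min (model B p F f L (x k))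
            (\<lambda>y. x k + (1 / \<beta>) *\<^sub>R (y - x k) \<in> dom_phi F Q f) (x (Suc k)))"

end

theory Submission
  imports Defs
begin

text \<open>
  Fix the current point \<open>x\<close> and write \<open>M(y)\<close> for the second argument of \<open>F\<close> in the model: the
  Taylor polynomial of \<open>f\<close> at \<open>x\<close> plus \<open>p L / (p + 1)! \<parallel>y - x\<parallel>\<^sup>p\<^sup>+\<^sup>1\<close>. By Taylor's theorem the
  polynomial differs from \<open>f(y)\<close> by at most \<open>L / (p + 1)! \<parallel>y - x\<parallel>\<^sup>p\<^sup>+\<^sup>1\<close> in each component
  (\<open>taylor_remainder_bounds\<close>). As \<open>p \<ge> 1\<close>, this gives \<open>f \<le> M\<close> on the domain, and in the other
  direction \<open>M(y) \<le> f(y) + L / p! \<parallel>y - x\<parallel>\<^sup>p\<^sup>+\<^sup>1\<close>.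

  Now compare with \<open>y = (1 - \<beta>) x + \<beta> z\<close>, which is feasible for the restricted subproblem whenever
  \<open>z\<close> lies in the domain of \<open>\<phi>\<close>. Here the excess over \<open>f(y)\<close> is at most
  \<open>L / p! \<beta>\<^sup>p\<^sup>+\<^sup>1 \<parallel>z - x\<parallel>\<^sup>p\<^sup>+\<^sup>1\<close>, while uniform convexity leaves a gap of at least
  \<open>\<sigma> / (p + 1) \<beta> (1 - \<beta>)\<^sup>p \<parallel>z - x\<parallel>\<^sup>p\<^sup>+\<^sup>1\<close> between the chord \<open>(1 - \<beta>) f(x) + \<beta> f(z)\<close> and \<open>f(y)\<close>
  (\<open>uniformly_convex_gap\<close>). The bound on \<open>\<beta>\<close> says exactly that the gap absorbs the excess
  (\<open>le_cond_betaD\<close>), so \<open>M(y)\<close> lies below the chord (\<open>model_argument_bounds\<close>).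

  Monotonicity and convexity of \<open>F\<close> then give, for the next iterate \<open>x'\<close>,
  \<open>\<phi>(x') \<le> F(x', M(x')) \<le> F(y, M(y)) \<le> (1 - \<beta>) \<phi>(x) + \<beta> \<phi>(z)\<close> (\<open>restricted_step\<close>). With \<open>z\<close> the
  minimizer this contracts the gap \<open>\<phi>(x) - \<phi>*\<close> by the factor \<open>1 - \<beta>\<close>, and the rate follows by
  induction.
\<close>

section \<open>Directional derivatives of smooth functions\<close>

lemma frechet_derivative_cong_open:
  assumes "open S" "x \<in> S" "\<And>z. z \<in> S \<Longrightarrow> g z = g' z"
  shows "frechet_derivative g (at x) = frechet_derivative g' (at x)"
proof -
  have "(g has_derivative D) (at x) \<longleftrightarrow> (g' has_derivative D) (at x)" for D
    using assms has_derivative_transform_within_open[of _ _ x UNIV S] by (metis (no_types, lifting))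
  then show ?thesis unfolding frechet_derivative_def by simp
qed

lemma C_times_on_cong:
  assumes "open S" "\<And>z. z \<in> S \<Longrightarrow> g z = g' z"
  shows "C_times_on p S g \<longleftrightarrow> C_times_on p S g'"
  using assms(2)
proof (induction p arbitrary: g g')
  case 0
  then show ?case by (simp cong: continuous_on_cong)
next
  case (Suc p)
  have "g differentiable (at x) \<longleftrightarrow> g' differentiable (at x)" if "x \<in> S" for x
    unfolding differentiable_def using assms(1) that Suc.prems
      has_derivative_transform_within_open[of _ _ x UNIV S] by (metis (no_types, lifting))
  moreover have "C_times_on p S (\<lambda>x. frechet_derivative g (at x) h) \<longleftrightarrow>
      C_times_on p S (\<lambda>x. frechet_derivative g' (at x) h)" for h
    using frechet_derivative_cong_open[OF assms(1) _ Suc.prems] by (intro Suc.IH) auto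
  ultimately show ?case by simp
qed

lemma has_real_derivative_along_line:
  fixes v :: "'a::real_normed_vector \<Rightarrow> real"
  assumes "v differentiable (at (z + t *\<^sub>R h))"
  shows "((\<lambda>s. v (z + s *\<^sub>R h)) has_real_derivative
           frechet_derivative v (at (z + t *\<^sub>R h)) h) (at t)"
proof -
  let ?D = "frechet_derivative v (at (z + t *\<^sub>R h))"
  have v: "(v has_derivative ?D) (at (z + t *\<^sub>R h))"
    using assms frechet_derivative_works by blast
  have "((\<lambda>s. z + s *\<^sub>R h) has_derivative (\<lambda>s. s *\<^sub>R h)) (at t)"
    by (auto intro!: derivative_eq_intros)
  from has_derivative_compose[OF this v]
  have "((\<lambda>s. v (z + s *\<^sub>R h)) has_derivative (\<lambda>s. ?D (s *\<^sub>R h))) (at t)" .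
  moreover have "(\<lambda>s. ?D (s *\<^sub>R h)) = (*) (?D h)"
    using has_derivative_linear[OF v] by (auto simp: linear_cmul)
  ultimately show ?thesis by (simp add: has_field_derivative_def)
qed

lemma deriv_along_line:
  fixes v :: "'a::real_normed_vector \<Rightarrow> real"
  assumes "v differentiable (at z)"
  shows "deriv (\<lambda>s. v (z + s *\<^sub>R h)) 0 = frechet_derivative v (at z) h"
  using has_real_derivative_along_line[of v z 0 h] assms by (simp add: DERIV_imp_deriv)

lemma Dmulti_cong:
  assumes "open S" "\<And>z. z \<in> S \<Longrightarrow> g z = g' z" "x \<in> S"
  shows "Dmulti g hs x = Dmulti g' hs x"
  using assms(3)
proof (induction hs arbitrary: x)
  case Nil
  then show ?case using assms by simp
next
  case (Cons h hs)
  have "((\<lambda>t::real. x + t *\<^sub>R h) \<longlongrightarrow> x + 0 *\<^sub>R h) (nhds 0)"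
    by (intro tendsto_intros) (simp add: filterlim_ident)
  then have "\<forall>\<^sub>F t::real in nhds 0. x + t *\<^sub>R h \<in> S"
    using topological_tendstoD[of _ _ _ S] assms(1) Cons.prems by fastforce
  then have "\<forall>\<^sub>F t in nhds 0. Dmulti g hs (x + t *\<^sub>R h) = Dmulti g' hs (x + t *\<^sub>R h)"
    by eventually_elim (rule Cons.IH)
  then show ?case by (simp add: deriv_cong_ev)
qed

text \<open>In \<open>Dmulti\<close> the head of the list is the direction differentiated last, whereas \<open>C_times_on\<close>
  unfolds from the first derivative taken. That each further direction costs one degree of
  smoothness is what reconciles the two orders.\<close>

lemma C_times_on_Dmulti:
  assumes "open S" "C_times_on p S g" "length hs \<le> p"
  shows "C_times_on (p - length hs) S (Dmulti g hs)"
  using assms(3)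
proof (induction hs)
  case Nil
  then show ?case using assms by simp
next
  case (Cons h hs)
  then have "p - length hs = Suc (p - length (h # hs))" by simp
  with Cons have C: "C_times_on (Suc (p - length (h # hs))) S (Dmulti g hs)" by simp
  then have "C_times_on (p - length (h # hs)) S (\<lambda>x. frechet_derivative (Dmulti g hs) (at x) h)"
    by simp
  moreover have "Dmulti g (h # hs) x = frechet_derivative (Dmulti g hs) (at x) h" if "x \<in> S" for x
    using C that by (simp add: deriv_along_line)
  ultimately show ?case using C_times_on_cong[OF assms(1)] by (metis (no_types, lifting))
qed

lemma Dmulti_differentiable:
  assumes "open S" "C_times_on p S g" "length hs < p" "x \<in> S"
  shows "Dmulti g hs differentiable (at x)"
proof -
  have "p - length hs = Suc (p - Suc (length hs))" using assms(3) by simp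
  with C_times_on_Dmulti[OF assms(1,2), of hs] assms(3)
  have "C_times_on (Suc (p - Suc (length hs))) S (Dmulti g hs)" by simp
  then show ?thesis using assms(4) by simp
qed

lemma Dmulti_Cons_eq_frechet:
  assumes "open S" "C_times_on p S g" "length hs < p" "x \<in> S"
  shows "Dmulti g (h # hs) x = frechet_derivative (Dmulti g hs) (at x) h"
  using Dmulti_differentiable[OF assms] by (simp add: deriv_along_line)

text \<open>Splitting off the last list element isolates the first differentiation; it permits induction on
  the order for all functions simultaneously.\<close>

lemma Dmulti_snoc: "Dmulti g (hs @ [h]) = Dmulti (Dmulti g [h]) hs"
  by (induction hs) auto

lemma Dmulti_linear_combination:
  assumes "open S" "\<And>b. b \<in> I \<Longrightarrow> C_times_on p S (G b)" "length hs \<le> p" "x \<in> S"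
  shows "Dmulti (\<lambda>z. \<Sum>b\<in>I. c b * G b z) hs x = (\<Sum>b\<in>I. c b * Dmulti (G b) hs x)"
  using assms(3,4)
proof (induction hs arbitrary: x)
  case Nil
  then show ?case by simp
next
  case (Cons h hs)
  have eq: "Dmulti (\<lambda>z. \<Sum>b\<in>I. c b * G b z) (h # hs) x
      = Dmulti (\<lambda>z. \<Sum>b\<in>I. c b * Dmulti (G b) hs z) [h] x"
    using Dmulti_cong[OF assms(1), of "Dmulti (\<lambda>z. \<Sum>b\<in>I. c b * G b z) hs"
        "\<lambda>z. \<Sum>b\<in>I. c b * Dmulti (G b) hs z" x "[h]"] Cons by simp
  have d: "((\<lambda>t. Dmulti (G b) hs (x + t *\<^sub>R h)) has_real_derivative Dmulti (G b) (h # hs) x) (at 0)"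
    if "b \<in> I" for b
    using has_real_derivative_along_line[of "Dmulti (G b) hs" x 0 h]
      Dmulti_differentiable[OF assms(1) assms(2)[OF that], of hs x]
      Dmulti_Cons_eq_frechet[OF assms(1) assms(2)[OF that], of hs x h] Cons.prems by simp
  have "((\<lambda>t. \<Sum>b\<in>I. c b * Dmulti (G b) hs (x + t *\<^sub>R h)) has_real_derivative
      (\<Sum>b\<in>I. c b * Dmulti (G b) (h # hs) x)) (at 0)"
    by (intro DERIV_sum DERIV_cmult d)
  then show ?case unfolding eq by (simp add: DERIV_imp_deriv)
qed

text \<open>The norm of the \<open>p\<close>th derivative is a supremum, which says something about its values only if
  these are bounded on bounded sets of directions. Expanding the innermost direction in the
  orthonormal basis reduces this to the \<open>(p - 1)\<close>st derivatives of the finitely many partial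
  derivatives of \<open>g\<close>.\<close>

lemma Dmulti_bounded:
  fixes g :: "'a::euclidean_space \<Rightarrow> real"
  assumes "open S" "C_times_on p S g" "x \<in> S"
  shows "\<exists>C. \<forall>hs. length hs = p \<longrightarrow> (\<forall>h\<in>set hs. norm h \<le> K) \<longrightarrow> \<bar>Dmulti g hs x\<bar> \<le> C"
  using assms(2)
proof (induction p arbitrary: g)
  case 0
  then show ?case by auto
next
  case (Suc p)
  have d: "Dmulti g [h] z = frechet_derivative g (at z) h" if "z \<in> S" for z h
    using Dmulti_Cons_eq_frechet[OF assms(1) Suc.prems, of "[]"] that by simp
  have C: "C_times_on p S (Dmulti g [h])" for h
    using C_times_on_Dmulti[OF assms(1) Suc.prems, of "[h]"] by simp
  have "\<forall>b. \<exists>C. \<forall>hs. length hs = p \<longrightarrow> (\<forall>h\<in>set hs. norm h \<le> K) \<longrightarrow>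
      \<bar>Dmulti (Dmulti g [b]) hs x\<bar> \<le> C"
    by (intro allI Suc.IH C)
  then obtain C where C_bound: "\<And>b hs. length hs = p \<Longrightarrow> \<forall>h\<in>set hs. norm h \<le> K \<Longrightarrow>
      \<bar>Dmulti (Dmulti g [b]) hs x\<bar> \<le> C b"
    by (drule_tac choice) blast
  have "\<bar>Dmulti g hs x\<bar> \<le> (\<Sum>b\<in>Basis. K * C b)"
    if len: "length hs = Suc p" and bnd: "\<forall>h\<in>set hs. norm h \<le> K" for hs
  proof -
    obtain hs' h where hs: "hs = hs' @ [h]" using len by (metis length_Suc_conv_rev)
    have len': "length hs' = p" and bnd': "\<forall>h\<in>set hs'. norm h \<le> K" and "norm h \<le> K"
      using len bnd hs by auto
    have expand: "Dmulti g [h] z = (\<Sum>b\<in>Basis. (h \<bullet> b) * Dmulti g [b] z)" if "z \<in> S" for z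
    proof -
      have lin: "linear (frechet_derivative g (at z))"
        using Suc.prems that linear_frechet_derivative by auto
      have "frechet_derivative g (at z) h
          = frechet_derivative g (at z) (\<Sum>b\<in>Basis. (h \<bullet> b) *\<^sub>R b)"
        by (simp add: euclidean_representation)
      also have "\<dots> = (\<Sum>b\<in>Basis. (h \<bullet> b) * frechet_derivative g (at z) b)"
        by (simp add: linear_sum[OF lin] linear_cmul[OF lin])
      finally show ?thesis by (simp only: d[OF that])
    qed
    have "Dmulti g hs x = Dmulti (\<lambda>z. \<Sum>b\<in>Basis. (h \<bullet> b) * Dmulti g [b] z) hs' x"
      unfolding hs Dmulti_snoc by (rule Dmulti_cong[OF assms(1) expand assms(3)])
    also have "\<dots> = (\<Sum>b\<in>Basis. (h \<bullet> b) * Dmulti (Dmulti g [b]) hs' x)"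
      by (rule Dmulti_linear_combination[OF assms(1) C _ assms(3)]) (simp add: len')
    finally have "\<bar>Dmulti g hs x\<bar> \<le> (\<Sum>b\<in>Basis. \<bar>(h \<bullet> b) * Dmulti (Dmulti g [b]) hs' x\<bar>)"
      by simp
    also have "\<dots> \<le> (\<Sum>b\<in>Basis. K * C b)"
    proof (rule sum_mono)
      fix b :: 'a assume "b \<in> Basis"
      then have "\<bar>h \<bullet> b\<bar> \<le> K" using Basis_le_norm \<open>norm h \<le> K\<close> order_trans by blast
      then show "\<bar>(h \<bullet> b) * Dmulti (Dmulti g [b]) hs' x\<bar> \<le> K * C b"
        unfolding abs_mult using C_bound[OF len' bnd'] by (intro mult_mono) auto
    qed
    finally show ?thesis .
  qed
  then show ?case by blast
qed

lemma Dmulti_replicate_scaleR: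
  assumes "open S" "C_times_on p S g" "k \<le> p" "x \<in> S"
  shows "Dmulti g (replicate k (c *\<^sub>R h)) x = c ^ k * Dmulti g (replicate k h) x"
  using assms(3,4)
proof (induction k arbitrary: x)
  case 0
  then show ?case by simp
next
  case (Suc k)
  let ?v = "Dmulti g (replicate k h)"
  have "Dmulti g (replicate (Suc k) (c *\<^sub>R h)) x = Dmulti (\<lambda>z. c ^ k * ?v z) [c *\<^sub>R h] x"
    using Dmulti_cong[OF assms(1), of "Dmulti g (replicate k (c *\<^sub>R h))" "\<lambda>z. c ^ k * ?v z" x
        "[c *\<^sub>R h]"] Suc by simp
  also have "\<dots> = c ^ k * (c * frechet_derivative ?v (at x) h)"
  proof -
    have dif: "?v differentiable (at x)"
      using Dmulti_differentiable[OF assms(1,2)] Suc.prems by simp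
    then have "frechet_derivative ?v (at x) (c *\<^sub>R h) = c * frechet_derivative ?v (at x) h"
      using linear_cmul[OF linear_frechet_derivative[OF dif], of c h] by simp
    with has_real_derivative_along_line[of ?v x 0 "c *\<^sub>R h"] dif
    have "((\<lambda>t. ?v (x + t *\<^sub>R c *\<^sub>R h)) has_real_derivative c * frechet_derivative ?v (at x) h) (at 0)"
      by simp
    from DERIV_cmult[OF this, of "c ^ k"] show ?thesis by (simp add: DERIV_imp_deriv)
  qed
  also have "\<dots> = c ^ Suc k * Dmulti g (replicate (Suc k) h) x"
    using Dmulti_Cons_eq_frechet[OF assms(1,2), of "replicate k h" x h] Suc.prems by simp
  finally show ?case .
qed

section \<open>The Euclidean norm defined by the operator\<close>

lemma Bnorm_nonneg [simp]: "0 \<le> Bnorm B h" if "self_adjoint_posdef B"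
  using that by (cases "h = 0") (auto simp: Bnorm_def self_adjoint_posdef_def less_imp_le)

lemma Bnorm_scaleR: "Bnorm B (c *\<^sub>R h) = \<bar>c\<bar> * Bnorm B h"
proof -
  have "B (c *\<^sub>R h) (c *\<^sub>R h) = c\<^sup>2 * B h h"
    by (simp add: blinfun.scaleR_left blinfun.scaleR_right power2_eq_square)
  then show ?thesis by (simp add: Bnorm_def real_sqrt_mult)
qed

text \<open>The \<open>B\<close>-norm is continuous and positive on the compact Euclidean unit sphere, so it has a
  positive minimum there; \<open>K\<close> is the reciprocal.\<close>

lemma norm_le_Bnorm:
  assumes "self_adjoint_posdef B"
  shows "\<exists>K. \<forall>h. norm h \<le> K * Bnorm B h"
proof -
  have cont: "continuous_on (sphere 0 1) (Bnorm B)"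
    unfolding Bnorm_def by (intro continuous_intros)
  have "sphere (0::'a) 1 \<noteq> {}" by simp
  then obtain e where e: "e \<in> sphere 0 1" "\<And>h. h \<in> sphere 0 1 \<Longrightarrow> Bnorm B e \<le> Bnorm B h"
    using continuous_attains_inf[OF compact_sphere _ cont] by blast
  have "e \<noteq> 0" using e(1) by auto
  then have pos: "Bnorm B e > 0" using assms by (auto simp: Bnorm_def self_adjoint_posdef_def)
  have "norm h \<le> (1 / Bnorm B e) * Bnorm B h" for h
  proof (cases "h = 0")
    case False
    then have "Bnorm B e \<le> Bnorm B ((1 / norm h) *\<^sub>R h)" by (intro e(2)) simp
    then show ?thesis using False pos by (simp add: Bnorm_scaleR field_simps)
  qed (use pos in \<open>simp add: Bnorm_def\<close>)
  then show ?thesis by blast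
qed

section \<open>The Taylor remainder\<close>

lemma has_real_derivative_power_over_fact:
  fixes s :: real
  shows "((\<lambda>s. c * s ^ Suc k / fact (Suc k)) has_real_derivative c * s ^ k / fact k) (at s)"
proof -
  have "((\<lambda>s. c * s ^ Suc k / fact (Suc k)) has_real_derivative
      c * (real (Suc k) * s ^ k) / fact (Suc k)) (at s)"
    using DERIV_cdivide[OF DERIV_cmult[OF DERIV_pow[of "Suc k" s UNIV], of c], of "fact (Suc k)"]
    by (simp del: fact_Suc power_Suc of_nat_Suc)
  also have "c * (real (Suc k) * s ^ k) / fact (Suc k) = c * s ^ k / fact k"
    by (simp add: divide_simps del: of_nat_Suc)
  finally show ?thesis .
qed

text \<open>Here \<open>u k\<close> is the \<open>k\<close>th derivative of \<open>u 0\<close>. The error minus its claimed bound vanishes at \<open>0\<close>,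
  and its derivative is the same expression for the shifted sequence and \<open>p - 1\<close>, hence nonpositive
  by induction.\<close>

lemma taylor_upper_bound_real:
  fixes u :: "nat \<Rightarrow> real \<Rightarrow> real"
  assumes "\<And>k t. k < p \<Longrightarrow> 0 \<le> t \<Longrightarrow> t \<le> r \<Longrightarrow> (u k has_real_derivative u (Suc k) t) (at t)"
    and "\<And>t. 0 \<le> t \<Longrightarrow> t \<le> r \<Longrightarrow> u p t - u p 0 \<le> M * t"
    and "0 \<le> t" "t \<le> r"
  shows "u 0 t - (\<Sum>k\<le>p. u k 0 * t ^ k / fact k) \<le> M * t ^ (p + 1) / fact (p + 1)"
  using assms
proof (induction p arbitrary: u t)
  case 0
  then show ?case by simp
next
  case (Suc p)
  define E where "E t = u 0 t - (\<Sum>k\<le>Suc p. u k 0 * t ^ k / fact k)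
      - M * t ^ (Suc p + 1) / fact (Suc p + 1)" for t
  have "E t \<le> E 0"
  proof (rule DERIV_nonpos_imp_nonincreasing[OF \<open>0 \<le> t\<close>])
    fix s assume s: "0 \<le> s" "s \<le> t"
    let ?d = "u 1 s - (\<Sum>k\<le>p. u (Suc k) 0 * s ^ k / fact k) - M * s ^ (p + 1) / fact (p + 1)"
    have 1: "((\<lambda>s. \<Sum>k\<le>p. u (Suc k) 0 * s ^ Suc k / fact (Suc k)) has_real_derivative
        (\<Sum>k\<le>p. u (Suc k) 0 * s ^ k / fact k)) (at s)"
      by (intro DERIV_sum has_real_derivative_power_over_fact)
    have 2: "(u 0 has_real_derivative u 1 s) (at s)" using Suc.prems s by simp
    have "(E has_real_derivative ?d) (at s)"
      unfolding E_def sum.atMost_Suc_shift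
      using DERIV_diff[OF DERIV_diff[OF 2 DERIV_add[OF DERIV_const 1]]
          has_real_derivative_power_over_fact[of M "Suc p"]]
      by (simp del: fact_Suc power_Suc)
    moreover have "?d \<le> 0"
      using Suc.IH[of "\<lambda>k. u (Suc k)" s] Suc.prems s by simp
    ultimately show "\<exists>y. (E has_real_derivative y) (at s) \<and> y \<le> 0" by blast
  qed
  moreover have "E 0 = 0" by (simp add: E_def sum.atMost_Suc_shift)
  ultimately show ?case by (simp add: E_def)
qed

lemma lipschitz_pth_derivD:
  fixes g :: "'a::euclidean_space \<Rightarrow> real"
  assumes "self_adjoint_posdef B" "open Q" "C_times_on p Q g" "lipschitz_pth_deriv B p Q g L"
    and "y \<in> Q" "z \<in> Q" "length hs = p" "\<And>h. h \<in> set hs \<Longrightarrow> Bnorm B h \<le> 1"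
  shows "Dmulti g hs y - Dmulti g hs z \<le> L * Bnorm B (y - z)"
proof -
  let ?A = "\<lambda>hs. Dmulti g hs y - Dmulti g hs z"
  let ?V = "{?A hs | hs. length hs = p \<and> (\<forall>h\<in>set hs. Bnorm B h \<le> 1)}"
  obtain K where K: "\<And>h. norm h \<le> K * Bnorm B h" using norm_le_Bnorm[OF assms(1)] by blast
  have unit: "norm h \<le> \<bar>K\<bar>" if "Bnorm B h \<le> 1" for h
  proof -
    have "K * Bnorm B h \<le> \<bar>K\<bar> * 1" using that assms(1) by (intro mult_mono) auto
    then show ?thesis using K[of h] by simp
  qed
  obtain C1 where C1: "\<And>hs. length hs = p \<Longrightarrow> \<forall>h\<in>set hs. norm h \<le> \<bar>K\<bar> \<Longrightarrow> \<bar>Dmulti g hs y\<bar> \<le> C1"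
    using Dmulti_bounded[OF assms(2,3,5)] by blast
  obtain C2 where C2: "\<And>hs. length hs = p \<Longrightarrow> \<forall>h\<in>set hs. norm h \<le> \<bar>K\<bar> \<Longrightarrow> \<bar>Dmulti g hs z\<bar> \<le> C2"
    using Dmulti_bounded[OF assms(2,3,6)] by blast
  have "v \<le> C1 + C2" if "v \<in> ?V" for v
    using that C1 C2 unit by (fastforce simp: abs_le_iff)
  then have "bdd_above ?V" by (auto simp: bdd_above_def)
  then have "?A hs \<le> form_norm B p ?A"
    unfolding form_norm_def by (rule cSup_upper[rotated]) (use assms in blast)
  also have "\<dots> \<le> L * Bnorm B (y - z)"
    using assms(4,5,6) by (simp add: lipschitz_pth_deriv_def)
  finally show ?thesis .
qed

text \<open>Restricted to the segment from \<open>x\<close> to \<open>y\<close>, parametrised by arc length, the one-dimensional bound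
  applies to \<open>g\<close> and to \<open>-g\<close>. A direction of \<open>B\<close>-norm at most one can be inserted directly into the
  Lipschitz estimate; homogeneity then turns its powers into the powers of \<open>y - x\<close> in the Taylor
  polynomial.\<close>

lemma taylor_remainder_bounds:
  fixes g :: "'a::euclidean_space \<Rightarrow> real"
  assumes B: "self_adjoint_posdef B" and Q: "open Q" "convex Q"
    and C: "C_times_on p Q g" and L: "lipschitz_pth_deriv B p Q g L"
    and x: "x \<in> Q" and y: "y \<in> Q"
  defines "T \<equiv> \<Sum>k\<le>p. Dmulti g (replicate k (y - x)) x / fact k"
  shows "\<bar>g y - T\<bar> \<le> L / fact (p + 1) * Bnorm B (y - x) ^ (p + 1)"
proof -
  define r where "r = Bnorm B (y - x)"
  have r0: "r \<ge> 0" using B by (simp add: r_def)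
  (* If y = x, then h = 0 serves as the direction and every t in {0..r} is 0. *)
  obtain h where h: "y - x = r *\<^sub>R h" "Bnorm B h \<le> 1" "r = 0 \<or> Bnorm B h = 1"
  proof (cases "y = x")
    case True
    show ?thesis by (rule that[of 0]) (use True in \<open>auto simp: r_def Bnorm_def\<close>)
  next
    case False
    then have "r > 0" using B by (simp add: r_def Bnorm_def self_adjoint_posdef_def)
    then show ?thesis
      by (intro that[of "(1 / r) *\<^sub>R (y - x)"]) (auto simp: Bnorm_scaleR r_def[symmetric])
  qed
  define u where "u k t = Dmulti g (replicate k h) (x + t *\<^sub>R h)" for k t
  have seg: "x + t *\<^sub>R h \<in> Q" if t: "0 \<le> t" "t \<le> r" for t
  proof (cases "r = 0")
    case True
    then show ?thesis using t x by simp
  next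
    case False
    have "x + t *\<^sub>R h = (1 - t / r) *\<^sub>R x + (t / r) *\<^sub>R (x + r *\<^sub>R h)"
      using False by (simp add: algebra_simps)
    also have "\<dots> = (1 - t / r) *\<^sub>R x + (t / r) *\<^sub>R y"
      using h(1) by (metis add_diff_cancel_left' diff_add_cancel add.commute)
    also have "\<dots> \<in> Q" using convexD_alt[OF Q(2) x y, of "t / r"] t False r0 by simp
    finally show ?thesis .
  qed
  have du: "(u k has_real_derivative u (Suc k) t) (at t)" if "k < p" "0 \<le> t" "t \<le> r" for k t
    using has_real_derivative_along_line[of "Dmulti g (replicate k h)" x t h]
      Dmulti_differentiable[OF Q(1) C, of "replicate k h"]
      Dmulti_Cons_eq_frechet[OF Q(1) C, of "replicate k h" _ h] seg that
    unfolding u_def by simp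
  have lip: "Dmulti g (replicate p h) a - Dmulti g (replicate p h) b \<le> L * Bnorm B (a - b)"
    if "a \<in> Q" "b \<in> Q" for a b
    using h(2) by (intro lipschitz_pth_derivD[OF B Q(1) C L that]) auto
  have speed: "Bnorm B (t *\<^sub>R h) = t" if "0 \<le> t" "t \<le> r" for t
    using h(3) that by (auto simp: Bnorm_scaleR)
  have up: "u p t - u p 0 \<le> L * t" and down: "u p 0 - u p t \<le> L * t" if "0 \<le> t" "t \<le> r" for t
    using lip[of "x + t *\<^sub>R h" x] lip[of x "x + t *\<^sub>R h"] seg[OF that] x speed[OF that]
      Bnorm_scaleR[of B "-1" "t *\<^sub>R h"] by (simp_all add: u_def)
  have y_eq: "u 0 r = g y" using h(1) by (simp add: u_def) (metis add.commute diff_add_cancel)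
  have T: "T = (\<Sum>k\<le>p. u k 0 * r ^ k / fact k)"
    unfolding T_def h(1) u_def
    by (intro sum.cong) (simp_all add: Dmulti_replicate_scaleR[OF Q(1) C _ x] mult.commute)
  have "g y - T \<le> L * r ^ (p + 1) / fact (p + 1)"
    unfolding T y_eq[symmetric] using r0 by (intro taylor_upper_bound_real[where r=r] du up) auto
  moreover have "- u 0 r - (\<Sum>k\<le>p. - u k 0 * r ^ k / fact k) \<le> L * r ^ (p + 1) / fact (p + 1)"
    using r0 down by (intro taylor_upper_bound_real[where r=r and u="\<lambda>k t. - u k t"] DERIV_minus du) auto
  then have "T - g y \<le> L * r ^ (p + 1) / fact (p + 1)"
    by (simp add: T y_eq sum_negf)
  ultimately show ?thesis by (simp add: r_def abs_le_iff)
qed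

lemma taylor_poly_component:
  "taylor_poly p f x y $ i = (\<Sum>k\<le>p. Dmulti (\<lambda>z. f z $ i) (replicate k (y - x)) x / fact k)"
proof -
  have "{..p} = insert 0 {1..p}" by auto
  then show ?thesis by (simp add: taylor_poly_def Dpow_def sum_component)
qed

section \<open>Uniform convexity along a segment\<close>

text \<open>The first two terms of the binomial expansion; the other terms are nonnegative.\<close>

lemma power_add_ge_two_terms:
  fixes a b :: real
  assumes "0 \<le> a" "0 \<le> b"
  shows "a ^ Suc n + Suc n * a ^ n * b \<le> (a + b) ^ Suc n"
proof (induction n)
  case (Suc n)
  have "a ^ Suc (Suc n) + Suc (Suc n) * a ^ Suc n * b
      \<le> (a + b) * (a ^ Suc n + Suc n * a ^ n * b)"
    using assms by (simp add: algebra_simps)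
  also have "\<dots> \<le> (a + b) * (a + b) ^ Suc n"
    using Suc assms by (intro mult_left_mono) auto
  finally show ?case by simp
qed simp

text \<open>The gap \<open>(1 - b) h(0) + b h(1) - h(b)\<close> equals \<open>b (1 - b)\<close> times the integral over \<open>t\<close> in
  \<open>[0, 1]\<close> of \<open>h'(b + (1 - b) t) - h'(b t)\<close>. The two arguments are \<open>(1 - b) t + b (1 - t)\<close>
  apart, so the integrand is at least
  \<open>c ((1 - b) t + b (1 - t))\<^sup>p \<ge> c ((1 - b)\<^sup>p t\<^sup>p + p (1 - b)\<^sup>p\<^sup>-\<^sup>1 t\<^sup>p\<^sup>-\<^sup>1 b (1 - t))\<close>, and the integral
  of the last expression is \<open>c (1 - b)\<^sup>p\<^sup>-\<^sup>1 / (p + 1)\<close>. Applying the first-order lower bound of a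
  uniformly convex function at \<open>b\<close> towards both endpoints would only give the weaker gap
  \<open>c / (p + 1) b (1 - b) (b\<^sup>p + (1 - b)\<^sup>p)\<close>, which for \<open>p > 1\<close> and small \<open>b\<close> lies below the
  one claimed.\<close>

lemma uniform_convexity_gap_real:
  fixes h h' :: "real \<Rightarrow> real"
  assumes p: "1 \<le> p" and b: "0 \<le> b" "b \<le> 1" and c: "0 \<le> c"
    and der: "\<And>t. 0 \<le> t \<Longrightarrow> t \<le> 1 \<Longrightarrow> (h has_real_derivative h' t) (at t)"
    and mono: "\<And>s t. 0 \<le> s \<Longrightarrow> s \<le> t \<Longrightarrow> t \<le> 1 \<Longrightarrow> c * (t - s) ^ p \<le> h' t - h' s"
  shows "h b + c / (p + 1) * b * (1 - b) ^ p \<le> (1 - b) * h 0 + b * h 1"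
proof -
  obtain n where n: "p = Suc n" using p by (cases p) auto
  (* ?P is an antiderivative of the two-term lower bound (without the factor c), and G is the
     antiderivative of the difference between the integrand and that bound; it suffices that G
     increases. *)
  let ?P = "\<lambda>t::real. (1 - b) ^ p * t ^ (p + 1) / (p + 1)
      + (1 - b) ^ n * b * (t ^ p - p * t ^ (p + 1) / (p + 1))"
  define G where "G t = b * h (b + (1 - b) * t) - (1 - b) * h (b * t) - b * (1 - b) * c * ?P t" for t
  have "G 0 \<le> G 1"
  proof (rule DERIV_nonneg_imp_nondecreasing[of 0 1 G])
    fix t :: real assume t: "0 \<le> t" "t \<le> 1"
    have bt: "b * t \<le> 1" "0 \<le> b * t" "b + (1 - b) * t \<le> 1" "b * t \<le> b + (1 - b) * t"
    proof -
      show "b * t \<le> 1" using b t by (simp add: mult_le_one)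
      show "0 \<le> b * t" using b t by simp
      have "(1 - b) * t \<le> (1 - b) * 1" using b t by (intro mult_left_mono) auto
      then show "b + (1 - b) * t \<le> 1" by simp
      have "b * t \<le> b * 1" "0 \<le> (1 - b) * t" using b t by (auto intro: mult_left_le)
      then show "b * t \<le> b + (1 - b) * t" by simp
    qed
    let ?q = "((1 - b) * t) ^ p + p * ((1 - b) * t) ^ n * (b * (1 - t))"
    have d1: "((\<lambda>t. h (b + (1 - b) * t)) has_real_derivative h' (b + (1 - b) * t) * (1 - b)) (at t)"
      using bt by (intro DERIV_chain2[where f=h and g="\<lambda>t. b + (1 - b) * t"] der)
        (auto intro!: derivative_eq_intros)
    have d2: "((\<lambda>t. h (b * t)) has_real_derivative h' (b * t) * b) (at t)"
      using bt by (intro DERIV_chain2[where f=h and g="\<lambda>t. b * t"] der)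
        (auto intro!: derivative_eq_intros)
    have pow: "((\<lambda>t::real. t ^ Suc k / real (Suc k)) has_real_derivative t ^ k) (at t)" for k
      using DERIV_cdivide[OF DERIV_pow[of "Suc k" t UNIV], of "real (Suc k)"]
      by (simp del: power_Suc of_nat_Suc)
    have "(?P has_real_derivative ?q) (at t)"
    proof -
      have "((\<lambda>t. (1 - b) ^ p * (t ^ Suc p / real (Suc p))
            + (1 - b) ^ n * b * (p * (t ^ Suc n / real (Suc n)) - p * (t ^ Suc p / real (Suc p))))
          has_real_derivative
          (1 - b) ^ p * t ^ p + (1 - b) ^ n * b * (p * t ^ n - p * t ^ p)) (at t)"
        by (intro DERIV_add DERIV_cmult DERIV_diff pow)
      moreover have "(1 - b) ^ p * t ^ p + (1 - b) ^ n * b * (p * t ^ n - p * t ^ p) = ?q"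
        unfolding n power_mult_distrib by (simp add: algebra_simps)
      moreover have "(\<lambda>t. (1 - b) ^ p * (t ^ Suc p / real (Suc p))
            + (1 - b) ^ n * b * (p * (t ^ Suc n / real (Suc n)) - p * (t ^ Suc p / real (Suc p)))) = ?P"
        unfolding n by (simp add: fun_eq_iff)
      ultimately show ?thesis by simp
    qed
    from DERIV_diff[OF DERIV_diff[OF DERIV_cmult[OF d1, of b] DERIV_cmult[OF d2, of "1 - b"]]
        DERIV_cmult[OF this, of "b * (1 - b) * c"]]
    have "(G has_real_derivative
        b * (1 - b) * (h' (b + (1 - b) * t) - h' (b * t) - c * ?q)) (at t)"
      unfolding G_def by (simp add: algebra_simps)
    moreover have "c * ?q \<le> h' (b + (1 - b) * t) - h' (b * t)"
    proof -
      have "?q \<le> ((1 - b) * t + b * (1 - t)) ^ p"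
        unfolding n using b t by (intro power_add_ge_two_terms) auto
      also have "(1 - b) * t + b * (1 - t) = b + (1 - b) * t - b * t" by (simp add: algebra_simps)
      finally have "c * ?q \<le> c * (b + (1 - b) * t - b * t) ^ p" using c by (rule mult_left_mono)
      also have "\<dots> \<le> h' (b + (1 - b) * t) - h' (b * t)" using bt by (intro mono) auto
      finally show ?thesis .
    qed
    then have "0 \<le> b * (1 - b) * (h' (b + (1 - b) * t) - h' (b * t) - c * ?q)" using b by simp
    ultimately show "\<exists>y. (G has_real_derivative y) (at t) \<and> 0 \<le> y" by blast
  qed simp
  moreover have "G 0 = b * h b - (1 - b) * h 0" by (simp add: G_def n)
  moreover have "G 1 = b * h 1 - (1 - b) * h b - c / (p + 1) * b * (1 - b) ^ p"
  proof -
    have frac: "1 - real p / real (p + 1) = 1 / real (p + 1)" by (simp add: divide_simps)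
    have "?P 1 = (1 - b) ^ p / real (p + 1) + (1 - b) ^ n * b * (1 - real p / real (p + 1))"
      by simp
    also have "\<dots> = ((1 - b) ^ p + (1 - b) ^ n * b) / real (p + 1)"
      unfolding frac by (simp only: add_divide_distrib times_divide_eq_right mult_1_right)
    also have "(1 - b) ^ p + (1 - b) ^ n * b = (1 - b) ^ n" by (simp add: n algebra_simps)
    finally have "?P 1 = (1 - b) ^ n / (p + 1)" .
    then show ?thesis by (simp add: G_def) (simp add: n)
  qed
  ultimately show ?thesis by (simp add: algebra_simps)
qed

text \<open>On the segment from \<open>x\<close> to \<open>z\<close> the derivative of \<open>g\<close> satisfies the growth condition of
  \<open>uniform_convexity_gap_real\<close>: dividing the inequality of uniform convexity between two points of
  the segment by their parameter distance lowers the exponent from \<open>p + 1\<close> to \<open>p\<close>.\<close>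

lemma uniformly_convex_gap:
  fixes g :: "'a::euclidean_space \<Rightarrow> real"
  assumes B: "self_adjoint_posdef B" and Q: "convex Q" and p: "1 \<le> p"
    and dif: "\<And>z. z \<in> Q \<Longrightarrow> g differentiable (at z)"
    and uc: "uniformly_convex_on B (p + 1) Q g \<sigma>" and \<sigma>: "0 \<le> \<sigma>"
    and x: "x \<in> Q" and z: "z \<in> Q" and b: "0 \<le> b" "b \<le> 1"
  shows "g ((1 - b) *\<^sub>R x + b *\<^sub>R z) + \<sigma> / (p + 1) * b * (1 - b) ^ p * Bnorm B (z - x) ^ (p + 1)
      \<le> (1 - b) * g x + b * g z"
proof -
  let ?d = "z - x" and ?r = "Bnorm B (z - x)"
  define D where "D t = frechet_derivative g (at (x + t *\<^sub>R ?d))" for t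
  have seg: "x + t *\<^sub>R ?d \<in> Q" if "0 \<le> t" "t \<le> 1" for t
    using convexD_alt[OF Q x z, of t] that by (simp add: algebra_simps)
  have incr: "\<sigma> * ?r ^ (p + 1) * (t - s) ^ p \<le> D t ?d - D s ?d"
    if "0 \<le> s" "s \<le> t" "t \<le> 1" for s t
  proof (cases "s = t")
    case True
    then show ?thesis using p by (simp add: power_0_left)
  next
    case False
    define w where "w = t - s"
    have w: "0 < w" using False that by (simp add: w_def)
    have S: "x + s *\<^sub>R ?d \<in> Q" "x + t *\<^sub>R ?d \<in> Q" using seg that by auto
    have lin: "linear (D s)" "linear (D t)"
      using dif S linear_frechet_derivative unfolding D_def by blast+
    have "x + t *\<^sub>R ?d - (x + s *\<^sub>R ?d) = w *\<^sub>R ?d" by (simp add: w_def algebra_simps)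
    then have "\<sigma> * Bnorm B (w *\<^sub>R ?d) ^ (p + 1) \<le> D t (w *\<^sub>R ?d) - D s (w *\<^sub>R ?d)"
      using uc S unfolding uniformly_convex_on_def D_def by metis
    then have "\<sigma> * (w ^ (p + 1) * ?r ^ (p + 1)) \<le> w * D t ?d - w * D s ?d"
      using w by (simp only: linear_cmul[OF lin(1)] linear_cmul[OF lin(2)] Bnorm_scaleR
          power_mult_distrib real_scaleR_def abs_of_pos)
    then have "w * (\<sigma> * ?r ^ (p + 1) * w ^ p) \<le> w * (D t ?d - D s ?d)"
      by (simp add: right_diff_distrib ac_simps)
    then show ?thesis using w by (simp add: w_def)
  qed
  have "g (x + b *\<^sub>R ?d) + \<sigma> * ?r ^ (p + 1) / (p + 1) * b * (1 - b) ^ p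
      \<le> (1 - b) * g (x + 0 *\<^sub>R ?d) + b * g (x + 1 *\<^sub>R ?d)"
  proof (rule uniform_convexity_gap_real[OF p b, where h' = "\<lambda>t. D t ?d"])
    show "0 \<le> \<sigma> * ?r ^ (p + 1)" using \<sigma> B by simp
    show "((\<lambda>t. g (x + t *\<^sub>R ?d)) has_real_derivative D t ?d) (at t)" if "0 \<le> t" "t \<le> 1" for t
      unfolding D_def using dif seg that by (intro has_real_derivative_along_line) auto
  qed (rule incr)
  moreover have "x + b *\<^sub>R ?d = (1 - b) *\<^sub>R x + b *\<^sub>R z" by (simp add: algebra_simps)
  ultimately show ?thesis by (simp add: ac_simps)
qed

section \<open>Linear convergence of the restricted method\<close>

lemma cond_beta_less_one: "cond_beta p \<gamma> \<alpha> < 1" if "0 < \<gamma>" "0 \<le> \<alpha>"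
proof -
  have "0 < (1 + \<alpha>) powr (1 / real p)" using that by simp
  moreover have "0 \<le> (fact p * \<gamma>) powr (1 / real p)" by simp
  ultimately show ?thesis
    by (simp add: cond_beta_def divide_less_eq add_pos_nonneg)
qed

text \<open>With \<open>a\<close> and \<open>s\<close> the two \<open>p\<close>th roots in \<open>cond_beta\<close>, the bound \<open>b \<le> s / (a + s)\<close> reads
  \<open>a b \<le> s (1 - b)\<close>; take \<open>p\<close>th powers.\<close>

lemma le_cond_betaD:
  assumes p: "1 \<le> p" and "0 < \<gamma>" "0 \<le> \<alpha>" "0 \<le> b" and b: "b \<le> cond_beta p \<gamma> \<alpha>"
  shows "(1 + \<alpha>) * b ^ p \<le> fact p * \<gamma> * (1 - b) ^ p"
proof -
  let ?a = "(1 + \<alpha>) powr (1 / real p)" and ?s = "(fact p * \<gamma>) powr (1 / real p)"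
  have pos: "0 < ?a" "0 < ?s" using assms by auto
  have root: "?a ^ p = 1 + \<alpha>" "?s ^ p = fact p * \<gamma>"
    using assms by (simp_all add: powr_power)
  have "b * (?a + ?s) \<le> ?s"
    using b pos by (simp add: cond_beta_def le_divide_eq add_pos_pos)
  then have "?a * b \<le> ?s * (1 - b)" by (simp add: algebra_simps)
  then have "(?a * b) ^ p \<le> (?s * (1 - b)) ^ p"
    using pos assms by (intro power_mono) auto
  then show ?thesis by (simp only: power_mult_distrib root)
qed

text \<open>For one component \<open>g\<close> of \<open>f\<close>, the argument \<open>M\<close> of the model lies above \<open>g\<close> but, at the point at
  fraction \<open>b\<close> of any segment from \<open>x\<close>, still below the chord of \<open>g\<close>. The regularisation
  is \<open>p\<close> times the bound on the Taylor remainder, so together they amount to \<open>1 + p\<close> times that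
  bound; this is why \<open>cond_beta\<close> is taken with parameter \<open>\<alpha> = p\<close>.\<close>

lemma model_argument_bounds:
  fixes g :: "'a::euclidean_space \<Rightarrow> real"
  assumes B: "self_adjoint_posdef B" and Q: "open Q" "convex Q" and p: "1 \<le> p"
    and C: "C_times_on p Q g" and L: "lipschitz_pth_deriv B p Q g L" "0 < L"
    and uc: "uniformly_convex_on B (p + 1) Q g \<sigma>" "0 < \<sigma>"
    and x: "x \<in> Q" and b: "0 < b" "b \<le> cond_beta p (cond_gamma \<sigma> L) (real p)"
  defines "M \<equiv> \<lambda>y. (\<Sum>k\<le>p. Dmulti g (replicate k (y - x)) x / fact k)
      + real p / fact (p + 1) * Bnorm B (y - x) ^ (p + 1) * L"
  shows "y \<in> Q \<Longrightarrow> g y \<le> M y"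
    and "z \<in> Q \<Longrightarrow> M ((1 - b) *\<^sub>R x + b *\<^sub>R z) \<le> (1 - b) * g x + b * g z"
proof -
  have rem: "\<bar>g y - (\<Sum>k\<le>p. Dmulti g (replicate k (y - x)) x / fact k)\<bar>
      \<le> L / fact (p + 1) * Bnorm B (y - x) ^ (p + 1)" if "y \<in> Q" for y
    using taylor_remainder_bounds[OF B Q C L(1) x that] .
  have coef: "0 \<le> L / fact (p + 1) * Bnorm B (y - x) ^ (p + 1)" for y
    using L(2) B by simp
  have M: "M y = (\<Sum>k\<le>p. Dmulti g (replicate k (y - x)) x / fact k)
      + real p * (L / fact (p + 1) * Bnorm B (y - x) ^ (p + 1))" for y
    unfolding M_def by simp
  show "g y \<le> M y" if "y \<in> Q"
  proof -
    have "1 * (L / fact (p + 1) * Bnorm B (y - x) ^ (p + 1))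
        \<le> real p * (L / fact (p + 1) * Bnorm B (y - x) ^ (p + 1))"
      using p coef by (intro mult_right_mono) auto
    then show ?thesis using rem[OF that] unfolding M by linarith
  qed
  show "M ((1 - b) *\<^sub>R x + b *\<^sub>R z) \<le> (1 - b) * g x + b * g z" if z: "z \<in> Q"
  proof -
    let ?y = "(1 - b) *\<^sub>R x + b *\<^sub>R z" and ?r = "Bnorm B (z - x)"
    have g0: "0 < cond_gamma \<sigma> L" using L uc by (simp add: cond_gamma_def)
    then have b1: "b \<le> 1" using b(2) cond_beta_less_one[OF g0, of "real p" p] by simp
    have y: "?y \<in> Q" using convexD_alt[OF Q(2) x z, of b] b b1 by simp
    have "?y - x = b *\<^sub>R (z - x)" by (simp add: algebra_simps)
    then have r: "Bnorm B (?y - x) ^ (p + 1) = b ^ (p + 1) * ?r ^ (p + 1)"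
      using b by (simp only: Bnorm_scaleR power_mult_distrib)
    have "M ?y \<le> g ?y + (real p + 1) * (L / fact (p + 1) * Bnorm B (?y - x) ^ (p + 1))"
      using rem[OF y] unfolding M distrib_right mult_1 by linarith
    also have "(real p + 1) * (L / fact (p + 1) * Bnorm B (?y - x) ^ (p + 1))
        = L / fact p * (b ^ (p + 1) * ?r ^ (p + 1))"
    proof -
      have "fact (p + 1) = (real p + 1) * fact p" by (simp add: add.commute)
      then have "(real p + 1) * (L / fact (p + 1)) = L / fact p" by (simp add: divide_simps)
      then show ?thesis unfolding r by (simp only: mult.assoc[symmetric])
    qed
    also have "\<dots> \<le> \<sigma> / (p + 1) * b * (1 - b) ^ p * ?r ^ (p + 1)"
    proof -
      have "(1 + real p) * b ^ p \<le> fact p * cond_gamma \<sigma> L * (1 - b) ^ p"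
        using le_cond_betaD[OF p g0 _ _ b(2)] b by simp
      then have "L / fact p * b ^ p \<le> \<sigma> / (p + 1) * (1 - b) ^ p"
        using L(2) by (simp add: cond_gamma_def field_simps)
      then have "L / fact p * b ^ p * (b * ?r ^ (p + 1)) \<le> \<sigma> / (p + 1) * (1 - b) ^ p * (b * ?r ^ (p + 1))"
        using b B by (intro mult_right_mono) auto
      then show ?thesis by (simp add: ac_simps)
    qed
    also have "g ?y + \<sigma> / (p + 1) * b * (1 - b) ^ p * ?r ^ (p + 1) \<le> (1 - b) * g x + b * g z"
    proof (rule uniformly_convex_gap[OF B Q(2) p _ uc(1) _ x z])
      show "g differentiable (at w)" if "w \<in> Q" for w
        using C p that by (cases p) auto
    qed (use uc b b1 in auto)
    finally show ?thesis by simp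
  qed
qed

lemma outer_function_mono:
  assumes "outer_function F" "u \<le> v" "F (y, w) < \<infinity>"
  shows "F (y, u) \<le> F (y, v)"
  using assms by (auto simp: outer_function_def)

lemma outer_function_convexD:
  assumes F: "outer_function F" and "F (x, u) \<le> ereal a" "F (z, v) \<le> ereal c" and b: "0 \<le> b" "b \<le> 1"
  shows "F ((1 - b) *\<^sub>R x + b *\<^sub>R z, (1 - b) *\<^sub>R u + b *\<^sub>R v) \<le> ereal ((1 - b) * a + b * c)"
proof -
  have "convex (ereal_epigraph F)" using F by (simp add: outer_function_def closed_convex_fun_def)
  from convexD_alt[OF this, of "((x, u), a)" "((z, v), c)" b] assms
  show ?thesis by (simp add: ereal_epigraph_def)
qed

text \<open>The comparison point \<open>z\<close> need not be a minimizer. Only upper bounds \<open>a\<close> and \<open>c\<close> for the values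
  of \<open>\<phi>\<close> enter, so that finiteness of \<open>\<phi>(x')\<close> is part of the conclusion and the step can be
  iterated.\<close>

lemma restricted_step:
  fixes f :: "'a::euclidean_space \<Rightarrow> real^'m"
  assumes p: "1 \<le> p" and B: "self_adjoint_posdef B" and F: "outer_function F"
    and f: "inner_function Q f"
    and C: "\<And>i. C_times_on p Q (\<lambda>z. f z $ i)"
    and L: "\<And>i. lipschitz_pth_deriv B p Q (\<lambda>z. f z $ i) (L $ i)" "\<And>i. 0 < L $ i"
    and uc: "\<And>i. uniformly_convex_on B (p + 1) Q (\<lambda>z. f z $ i) (\<sigma> $ i)" "\<And>i. 0 < \<sigma> $ i"
    and b: "0 < b" "b \<le> beta_hat p \<sigma> L"
    and step: "is_arg_min (model B p F f L x) (\<lambda>y. x + (1 / b) *\<^sub>R (y - x) \<in> dom_phi F Q f) x'"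
    and x: "x \<in> Q" "F (x, f x) \<le> ereal a" and z: "z \<in> Q" "F (z, f z) \<le> ereal c"
  shows "x' \<in> Q \<and> F (x', f x') \<le> ereal ((1 - b) * a + b * c)"
proof -
  have Q: "open Q" "convex Q" using f by (auto simp: inner_function_def)
  have bi: "b \<le> cond_beta p (cond_gamma (\<sigma> $ i) (L $ i)) (real p)" for i
    using b(2) unfolding beta_hat_def by (simp add: Min_ge_iff)
  (* Every component forces b < 1; undefined merely names one of them. *)
  have b1: "b \<le> 1"
    using bi[of undefined] cond_beta_less_one[of "cond_gamma (\<sigma> $ undefined) (L $ undefined)" "real p" p]
      L(2) uc(2) by (simp add: cond_gamma_def)
  define M where "M y = taylor_poly p f x y + (real p / fact (p + 1) * Bnorm B (y - x) ^ (p + 1)) *\<^sub>R L" for y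
  have model: "model B p F f L x y = F (y, M y)" for y by (simp add: model_def M_def)
  have M: "M y $ i = (\<Sum>k\<le>p. Dmulti (\<lambda>z. f z $ i) (replicate k (y - x)) x / fact k)
      + real p / fact (p + 1) * Bnorm B (y - x) ^ (p + 1) * L $ i" for y i
    by (simp add: M_def taylor_poly_component)
  note bounds = model_argument_bounds[OF B Q p C L uc x(1) b(1) bi]
  have above: "f y \<le> M y" if "y \<in> Q" for y
    unfolding less_eq_vec_def M using bounds(1)[OF that] by simp
  let ?y = "(1 - b) *\<^sub>R x + b *\<^sub>R z"
  have below: "M ?y \<le> (1 - b) *\<^sub>R f x + b *\<^sub>R f z"
    unfolding less_eq_vec_def M using bounds(2)[OF z(1)] by simp
  have conv: "F (?y, (1 - b) *\<^sub>R f x + b *\<^sub>R f z) \<le> ereal ((1 - b) * a + b * c)"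
    using b b1 by (intro outer_function_convexD[OF F x(2) z(2)]) auto
  have "x + (1 / b) *\<^sub>R (?y - x) = z"
    using b by (simp add: algebra_simps)
  moreover have "z \<in> dom_phi F Q f" using z by (auto simp: dom_phi_def)
  ultimately have "F (x', M x') \<le> F (?y, M ?y)"
    using step by (auto simp: is_arg_min_def model not_less)
  also have "\<dots> \<le> F (?y, (1 - b) *\<^sub>R f x + b *\<^sub>R f z)"
    using conv by (intro outer_function_mono[OF F below, where w = "(1 - b) *\<^sub>R f x + b *\<^sub>R f z"]) auto
  finally have le: "F (x', M x') \<le> ereal ((1 - b) * a + b * c)" using conv by simp
  (* The restriction on the next iterate says that it is a convex combination of x and a point of
     the domain; hence it belongs to Q, where the model lies above f. *)
  define w where "w = x + (1 / b) *\<^sub>R (x' - x)"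
  have "w \<in> Q" using step by (auto simp: is_arg_min_def dom_phi_def w_def)
  moreover have "x' = (1 - b) *\<^sub>R x + b *\<^sub>R w" using b by (simp add: w_def algebra_simps)
  ultimately have x': "x' \<in> Q" using convexD_alt[OF Q(2) x(1), of w b] b b1 by simp
  have "F (x', f x') \<le> F (x', M x')"
    using le by (intro outer_function_mono[OF F above[OF x'], where w = "M x'"]) auto
  with le x' show ?thesis by simp
qed

theorem theorem2:
  fixes B :: "'a::euclidean_space \<Rightarrow>\<^sub>L 'a \<Rightarrow>\<^sub>L real"
    and F :: "'a \<times> (real^'m) \<Rightarrow> ereal"
    and Q :: "'a set"
    and f :: "'a \<Rightarrow> real^'m"
    and L \<sigma> :: "real^'m"
    and p :: nat
    and \<beta> :: real
    and xs :: 'a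
    and \<phi>s :: ereal
    and x :: "nat \<Rightarrow> 'a"
  assumes "p \<ge> 1"
    and "self_adjoint_posdef B"
    and "outer_function F"
    and "inner_function Q f"
    and "\<And>i. C_times_on p Q (\<lambda>z. f z $ i)"
    and "\<And>i. L $ i > 0"
    and "\<And>i. lipschitz_pth_deriv B p Q (\<lambda>z. f z $ i) (L $ i)"
    and "\<And>i. \<sigma> $ i > 0"
    and "\<And>i. uniformly_convex_on B (p + 1) Q (\<lambda>z. f z $ i) (\<sigma> $ i)"
    and "\<phi>s = (INF y\<in>dom_phi F Q f. phi F Q f y)"
    and "xs \<in> dom_phi F Q f" and "phi F Q f xs = \<phi>s"
    and "0 < \<beta>" and "\<beta> \<le> beta_hat p \<sigma> L"
    and "restricted_basic_method B p F Q f L \<beta> x"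
  shows "\<forall>k. phi F Q f (x k) - \<phi>s \<le> ereal ((1 - \<beta>) ^ k) * (phi F Q f (x 0) - \<phi>s)"
proof
  have real: "\<exists>a. F (y, f y) = ereal a" if "y \<in> dom_phi F Q f" for y
    using that \<open>outer_function F\<close>
    by (cases "F (y, f y)") (auto simp: dom_phi_def outer_function_def closed_convex_fun_def)
  have x0: "x 0 \<in> dom_phi F Q f"
    and step: "\<And>k. is_arg_min (model B p F f L (x k))
        (\<lambda>y. x k + (1 / \<beta>) *\<^sub>R (y - x k) \<in> dom_phi F Q f) (x (Suc k))"
    using \<open>restricted_basic_method B p F Q f L \<beta> x\<close> by (auto simp: restricted_basic_method_def)
  obtain a c where a: "F (x 0, f (x 0)) = ereal a" and c: "F (xs, f xs) = ereal c"
    using real x0 \<open>xs \<in> dom_phi F Q f\<close> by meson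
  have Q: "x 0 \<in> Q" "xs \<in> Q" using x0 \<open>xs \<in> dom_phi F Q f\<close> by (auto simp: dom_phi_def)
  have bound: "x k \<in> Q \<and> F (x k, f (x k)) \<le> ereal (c + (1 - \<beta>) ^ k * (a - c))" for k
  proof (induction k)
    case 0
    then show ?case using Q a by simp
  next
    case (Suc k)
    then have "x (Suc k) \<in> Q \<and> F (x (Suc k), f (x (Suc k)))
        \<le> ereal ((1 - \<beta>) * (c + (1 - \<beta>) ^ k * (a - c)) + \<beta> * c)"
      using Q(2) c assms step[of k] by (intro restricted_step[where L = L and \<sigma> = \<sigma> and x = "x k" and z = xs]) auto
    then show ?case by (simp add: algebra_simps)
  qed
  fix k
  have \<phi>s: "\<phi>s = ereal c" using \<open>phi F Q f xs = \<phi>s\<close> Q c by (simp add: phi_def)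
  have "phi F Q f (x k) - \<phi>s \<le> ereal (c + (1 - \<beta>) ^ k * (a - c)) - ereal c"
    unfolding \<phi>s using bound[of k] by (intro ereal_minus_mono) (auto simp: phi_def)
  also have "\<dots> = ereal ((1 - \<beta>) ^ k) * (phi F Q f (x 0) - \<phi>s)"
    using Q a by (simp add: phi_def \<phi>s)
  finally show "phi F Q f (x k) - \<phi>s \<le> ereal ((1 - \<beta>) ^ k) * (phi F Q f (x 0) - \<phi>s)" .
qed

end
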